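(* Let $n\ge 4$ and let $x,y\in PT_n$ be distinct pyramidal tours with codes $x^c,y^c\in\{0,1\}^{\{3,\dots,n-1\}}$. The vertices $x^v$ and $y^v$ of $\mathrm{PYR}(n)$ are not adjacent if and only if at least one of the following two conditions holds: (1) there exists $k$ with $3<k<n-2$ such that $x^c_k=y^c_k\neq x^c_{k+1}=y^c_{k+1}$, and there exist $i$ with $3\le i<k$ and $j$ with $k+1<j\le n-1$ such that $x^c_i\ne y^c_i$ and $x^c_j\neq y^c_j$; (2) there exists $k$ with $3\le k<n-2$ such that $x^c_k=y^c_{k+1}\neq x^c_{k+1}=y^c_k$, and there exists $j$ with $k+1<j\le n-1$ such that $x^c_j=y^c_j$.
   Context: Let $K_n$ be the complete undirected graph on vertex set $\{1,\dots,n\}$ with edge set $E$. A Hamiltonian cycle $\langle 1,i_1,\dots,i_r,n,j_1,\dots,j_{n-r-2}\rangle$ is called a pyramidal tour if $i_1<i_2<\dots<i_r$ and $j_1>j_2>\dots>j_{n-r-2}$ (the tour leaves city $1$, visits some cities in increasing order, reaches city $n$, and returns to $1$ visiting the remaining cities in decreasing order); tours are undirected. Let $PT_n$ be the set of all pyramidal tours. For $x\in PT_n$ its characteristic vector $x^v\in\mathbb{R}^E$ has $x^v_e=1$ if edge $e$ lies in $x$ and $0$ otherwise. The pyramidal tours polytope is $\mathrm{PYR}(n)=\operatorname{conv}\{x^v : x\in PT_n\}$. Every pyramidal tour contains the edge $\{1,2\}$; the tour is oriented so that vertex $2$ belongs to the increasing part. The code of $x$ is the $0/1$ vector $x^c=(x^c_3,\dots,x^c_{n-1})$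 with $x^c_i=1$ if vertex $i$ is visited in the increasing part of $x$ (between $1$ and $n$ when travelling $1\to 2\to\cdots$) and $x^c_i=0$ otherwise. The map $x\mapsto x^c$ is a bijection from $PT_n$ onto $\{0,1\}^{n-3}$. *)

theory Defs
  imports "HOL-Analysis.Analysis" "HOL-Library.Function_Algebras"
begin

section \<open>Real vector space structure on functions (pointwise), so that R^E = (edge => real)\<close>

instantiation "fun" :: (type, real_vector) real_vector
begin
definition scaleR_fun :: "real \<Rightarrow> ('a \<Rightarrow> 'b) \<Rightarrow> 'a \<Rightarrow> 'b" where
  "scaleR_fun r f = (\<lambda>x. r *\<^sub>R f x)"
instance
  by standard (auto simp: scaleR_fun_def fun_eq_iff scaleR_add_right scaleR_add_left)
end

definition edges_Kn :: "nat \<Rightarrow> nat set set" where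
  "edges_Kn n = {{i, j} | i j. i \<in> {1..n} \<and> j \<in> {1..n} \<and> i \<noteq> j}"

definition cycle_edges :: "nat list \<Rightarrow> nat set set" where
  "cycle_edges xs = {{xs ! i, xs ! ((i + 1) mod length xs)} | i. i < length xs}"

definition pyr_list :: "nat \<Rightarrow> nat list \<Rightarrow> bool" where
  "pyr_list n xs \<longleftrightarrow> distinct xs \<and> set xs = {1..n} \<and>
     (\<exists>as bs. xs = [1] @ as @ [n] @ bs \<and> sorted_wrt (<) as \<and> sorted_wrt (>) bs)"

definition PT :: "nat \<Rightarrow> nat set set set" where
  "PT n = {cycle_edges xs | xs. pyr_list n xs}"

definition charvec :: "nat set set \<Rightarrow> (nat set \<Rightarrow> real)" where
  "charvec x = (\<lambda>e. if e \<in> x then 1 else 0)"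

definition PYR :: "nat \<Rightarrow> (nat set \<Rightarrow> real) set" where
  "PYR n = convex hull (charvec ` PT n)"

definition adjacent_vertices :: "'a::real_vector set \<Rightarrow> 'a \<Rightarrow> 'a \<Rightarrow> bool" where
  "adjacent_vertices P u v \<longleftrightarrow> (convex hull {u, v}) face_of P"

text \<open>The increasing part (between 1 and n), with the tour oriented so that vertex 2
  belongs to the increasing part; the code is the set of vertices i in {3..n-1}
  lying in the increasing part (x^c_i = 1 iff i in the code).\<close>
definition incr_part :: "nat \<Rightarrow> nat list \<Rightarrow> nat set" where
  "incr_part n xs = (let as = takeWhile (\<lambda>v. v \<noteq> n) (tl xs);
                         bs = tl (dropWhile (\<lambda>v. v \<noteq> n) (tl xs))
                     in if 2 \<in> set as then set as else set bs)"

definition code :: "nat \<Rightarrow> nat list \<Rightarrow> nat \<Rightarrow> bool" where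
  "code n xs i \<longleftrightarrow> i \<in> incr_part n xs"

end

theory Submission
  imports Defs
begin

text \<open>Call \<open>k \<in> {2..n - 2}\<close> a switch of a tour if \<open>k\<close> and \<open>k + 1\<close> lie in different parts of it. A tour
  is determined by its set of switches \<open>X\<close>, every \<open>X \<subseteq> {2..n - 2}\<close> occurs, and the edges of the tour are
  read off the path from \<open>1\<close> to \<open>n - 1\<close> through \<open>X\<close>. So \<open>PYR(n)\<close> is the polytope of all increasing
  paths from \<open>1\<close> to \<open>n - 1\<close>, where \<open>X\<close> and \<open>Y\<close> are nonadjacent iff they have a common switch \<open>k\<close>
  and differ both below and above it: in that case exchanging the tails at \<open>k\<close> gives two other
  tours with the same midpoint; otherwise the union of the two tours contains no third tour, and
  the segment is the face on which the coordinates outside this union vanish. Finally the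
  conditions (1) and (2) are the cases in which the codes agree, respectively differ, at \<open>k\<close>.\<close>

subsection \<open>Faces spanned by 0/1 vectors\<close>

text \<open>The coordinates of \<open>charvec c\<close> are 0 or 1. One in which it differs from
  \<open>charvec a\<close> forces weight 0 on \<open>a\<close>, one in which it differs from
  \<open>charvec b\<close> forces weight 0 on \<open>b\<close>, but the weights sum to 1.\<close>

lemma charvec_in_segment:
  assumes "charvec c \<in> convex hull {charvec a, charvec b}"
  shows "c = a \<or> c = b"
proof -
  obtain u v where uv: "u \<ge> 0" "v \<ge> 0" "u + v = 1"
    and eq: "charvec c = u *\<^sub>R charvec a + v *\<^sub>R charvec b"
    using assms unfolding convex_hull_2 by blast
  have pt: "charvec c e = u * charvec a e + v * charvec b e" for e
    using fun_cong[OF eq, of e] by (simp add: scaleR_fun_def)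
  show ?thesis
  proof (rule ccontr)
    assume "\<not> ?thesis"
    then obtain e f where "(e \<in> c) \<noteq> (e \<in> a)" "(f \<in> c) \<noteq> (f \<in> b)" by blast
    then show False
      using pt[of e] pt[of f] uv by (auto simp: charvec_def split: if_splits)
  qed
qed

text \<open>All coordinates are nonnegative, so nothing cancels: a convex combination that vanishes
  off \<open>A\<close> puts positive weight only on vectors that vanish off \<open>A\<close>
  themselves.\<close>

lemma convex_hull_charvec_vanishing:
  assumes "p \<in> convex hull (charvec ` F)" "\<And>e. e \<notin> A \<Longrightarrow> p e = 0"
  shows "p \<in> convex hull (charvec ` {t \<in> F. t \<subseteq> A})"
proof -
  let ?Q = "convex hull (charvec ` {t \<in> F. t \<subseteq> A})"
  \<comment> \<open>A convex set that contains the generators and encodes the claim. Nonnegativity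
    is part of it because the implication alone need not survive convex combinations.\<close>
  let ?C = "{p. (\<forall>e. p e \<ge> 0) \<and> ((\<forall>e. e \<notin> A \<longrightarrow> p e = 0) \<longrightarrow> p \<in> ?Q)}"
  have "convex ?C"
  proof (intro iffD2[OF convex_alt] ballI allI impI)
    fix p q :: "nat set \<Rightarrow> real" and u :: real
    assume p: "p \<in> ?C" and q: "q \<in> ?C" and u: "0 \<le> u \<and> u \<le> 1"
    let ?r = "(1 - u) *\<^sub>R p + u *\<^sub>R q"
    have r: "?r e = (1 - u) * p e + u * q e" for e
      by (simp add: scaleR_fun_def)
    have "?r \<in> ?Q" if z: "\<forall>e. e \<notin> A \<longrightarrow> ?r e = 0"
    \<comment> \<open>With weight 0 or 1 the combination is one endpoint and gives no information on
      the other, so this case is separate.\<close>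
    proof (cases "u = 0 \<or> u = 1")
      case True
      then show ?thesis using p q z by auto
    next
      case False
      have "p e = 0 \<and> q e = 0" if "e \<notin> A" for e
      proof -
        have "(1 - u) * p e \<ge> 0" "u * q e \<ge> 0" using p q u by auto
        moreover have "(1 - u) * p e + u * q e = 0" using z that r by simp
        ultimately have "(1 - u) * p e = 0" "u * q e = 0" by linarith+
        then show ?thesis using False by auto
      qed
      then have "p \<in> ?Q" "q \<in> ?Q" using p q by auto
      then show ?thesis
        using u by (simp add: convexD_alt convex_convex_hull)
    qed
    moreover have "?r e \<ge> 0" for e
      using p q u unfolding r by auto
    ultimately show "?r \<in> ?C" by blast
  qed
  moreover have "charvec ` F \<subseteq> ?C"
  proof (rule image_subsetI)
    fix t assume "t \<in> F"
    have "t \<subseteq> A" if "\<forall>e. e \<notin> A \<longrightarrow> charvec t e = 0"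
      using that by (force simp: charvec_def split: if_splits)
    with \<open>t \<in> F\<close> show "charvec t \<in> ?C" by (auto simp: charvec_def intro!: hull_inc)
  qed
  ultimately have "convex hull (charvec ` F) \<subseteq> ?C" by (rule hull_minimal[rotated])
  then show ?thesis using assms by blast
qed

text \<open>The coordinates outside \<open>a \<union> b\<close> are nonnegative on the polytope, and
  by \<open>only\<close> the points where they all vanish form exactly the segment, which is
  therefore a face.\<close>

lemma adjacent_verticesI_subset_Un:
  assumes "a \<in> F" "b \<in> F" and only: "\<And>t. t \<in> F \<Longrightarrow> t \<subseteq> a \<union> b \<Longrightarrow> t = a \<or> t = b"
  shows "adjacent_vertices (convex hull (charvec ` F)) (charvec a) (charvec b)"
proof -
  let ?P = "convex hull (charvec ` F)" and ?S = "convex hull {charvec a, charvec b}"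
  have sub: "?S \<subseteq> ?P" using assms(1,2) by (intro hull_mono) auto
  have nonneg: "p e \<ge> 0" if "p \<in> ?P" for p e
  proof -
    have "convex {p :: nat set \<Rightarrow> real. p e \<ge> 0}"
      by (auto simp: convex_alt scaleR_fun_def)
    moreover have "charvec ` F \<subseteq> {p. p e \<ge> 0}" by (auto simp: charvec_def)
    ultimately have "?P \<subseteq> {p. p e \<ge> 0}" by (rule hull_minimal[rotated])
    then show ?thesis using that by blast
  qed
  have in_S: "p \<in> ?S" if "p \<in> ?P" "\<And>e. e \<notin> a \<union> b \<Longrightarrow> p e = 0" for p
  proof -
    have "p \<in> convex hull (charvec ` {t \<in> F. t \<subseteq> a \<union> b})"
      by (rule convex_hull_charvec_vanishing[OF that])
    moreover have "charvec ` {t \<in> F. t \<subseteq> a \<union> b} \<subseteq> {charvec a, charvec b}"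
      using only by blast
    ultimately show ?thesis using hull_mono by blast
  qed
  have "p \<in> ?S \<and> q \<in> ?S"
    if p: "p \<in> ?P" and q: "q \<in> ?P" and z: "z \<in> ?S" and seg: "z \<in> open_segment p q" for p q z
  proof -
    obtain u where u: "0 < u" "u < 1" and zu: "z = (1 - u) *\<^sub>R p + u *\<^sub>R q"
      using seg unfolding in_segment by blast
    obtain v w where vw: "z = v *\<^sub>R charvec a + w *\<^sub>R charvec b"
      using z unfolding convex_hull_2 by blast
    have "p e = 0 \<and> q e = 0" if "e \<notin> a \<union> b" for e
    proof -
      have "z e = 0" using that unfolding vw by (simp add: scaleR_fun_def charvec_def)
      then have "(1 - u) * p e + u * q e = 0" unfolding zu by (simp add: scaleR_fun_def)
      moreover have "(1 - u) * p e \<ge> 0" "u * q e \<ge> 0" using nonneg p q u by auto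
      ultimately have "(1 - u) * p e = 0" "u * q e = 0" by linarith+
      then show ?thesis using u by auto
    qed
    then show ?thesis using in_S p q by blast
  qed
  then show ?thesis
    unfolding adjacent_vertices_def face_of_def using sub convex_convex_hull by blast
qed

text \<open>The two segments share their midpoint. A face containing it also contains
  \<open>charvec c\<close>, and then \<open>charvec_in_segment\<close> identifies \<open>c\<close>
  with \<open>a\<close> or \<open>b\<close>.\<close>

lemma not_adjacent_verticesI:
  assumes "c \<in> F" "d \<in> F" and sum: "charvec c + charvec d = charvec a + charvec b"
    and "c \<noteq> a" "c \<noteq> b"
  shows "\<not> adjacent_vertices (convex hull (charvec ` F)) (charvec a) (charvec b)"
proof
  let ?P = "convex hull (charvec ` F)" and ?S = "convex hull {charvec a, charvec b}"
  let ?z = "(1 / 2) *\<^sub>R charvec a + (1 / 2) *\<^sub>R charvec b"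
  assume "adjacent_vertices ?P (charvec a) (charvec b)"
  then have face: "?S face_of ?P" by (simp add: adjacent_vertices_def)
  have P: "charvec c \<in> ?P" "charvec d \<in> ?P" using assms(1,2) by (auto intro: hull_inc)
  have zS: "?z \<in> ?S" unfolding convex_hull_2
    by (rule CollectI, rule exI[of _ "1/2"], rule exI[of _ "1/2"]) auto
  have z_eq: "?z = (1 - 1 / 2) *\<^sub>R charvec c + (1 / 2) *\<^sub>R charvec d"
    using sum by (simp flip: scaleR_add_right)
  \<comment> \<open>An open segment with equal ends is empty, so this case must be excluded first:
    there the midpoint would be \<open>charvec c\<close> itself.\<close>
  have "c \<noteq> d"
  proof
    assume "c = d"
    then have "?z = charvec c" unfolding z_eq by (simp flip: scaleR_add_left)
    then show False using zS charvec_in_segment assms by metis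
  qed
  then have "charvec c \<noteq> charvec d" by (auto simp: charvec_def fun_eq_iff split: if_splits)
  then have "?z \<in> open_segment (charvec c) (charvec d)"
    unfolding in_segment using z_eq by (intro conjI exI[of _ "1/2"]) auto
  then have "charvec c \<in> ?S" using face P zS unfolding face_of_def by blast
  then show False using charvec_in_segment assms by blast
qed

subsection \<open>Paths of switches\<close>

definition arcs :: "nat set \<Rightarrow> (nat \<times> nat) set" where
  "arcs C = {(u, v). u \<in> C \<and> v \<in> C \<and> u < v \<and> C \<inter> {u<..<v} = {}}"

definition switch_closure :: "nat \<Rightarrow> nat set \<Rightarrow> nat set" where
  "switch_closure n X = insert 1 (insert (n - 1) X)"

text \<open>Consecutive elements \<open>u < v\<close> of \<open>X \<union> {1, n - 1}\<close> enclose a maximal run \<open>u + 1, \<dots>, v\<close> of vertices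
  in the same part; the other part passes over this run by the edge \<open>{u, v + 1}\<close>.\<close>

definition tour_edges :: "nat \<Rightarrow> nat set \<Rightarrow> nat set set" where
  "tour_edges n X = {{u, u + 1} | u. u \<in> {1..n - 1} - X} \<union>
     {{u, v + 1} | u v. (u, v) \<in> arcs (switch_closure n X)}"

lemma ex_arc_over:
  assumes "finite C" "u \<in> C" "v \<in> C" "u \<le> d" "d < v"
  obtains a b where "(a, b) \<in> arcs C" "a \<le> d" "d < b"
proof -
  let ?L = "C \<inter> {..d}" and ?R = "C \<inter> {d<..}"
  have L: "finite ?L" "?L \<noteq> {}" and R: "finite ?R" "?R \<noteq> {}" using assms by auto
  note m = Max_in[OF L] Min_in[OF R]
  have "C \<inter> {Max ?L<..<Min ?R} = {}"
  proof (intro equals0I)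
    fix w assume "w \<in> C \<inter> {Max ?L<..<Min ?R}"
    then show False using Max_ge[OF L(1), of w] Min_le[OF R(1), of w]
      by (simp add: not_less[symmetric] del: Max_less_iff Min_gr_iff) linarith
  qed
  then have "(Max ?L, Min ?R) \<in> arcs C" using m by (auto simp: arcs_def)
  with m that show thesis by blast
qed

lemma arcsD:
  assumes "(u, v) \<in> arcs C"
  shows "u \<in> C" "v \<in> C" "u < v" "w \<in> C \<Longrightarrow> w \<le> u \<or> v \<le> w"
  using assms by (auto simp: arcs_def disjoint_iff not_less)

text \<open>Every element of \<open>C\<close> is an end of some arc of \<open>C\<close>, hence lies
  in \<open>D\<close>. An element of \<open>D\<close> outside \<open>C\<close> would lie strictly
  inside an arc of \<open>C\<close>, which cannot then be an arc of \<open>D\<close>.\<close>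

lemma arcs_subset_imp_eq:
  assumes "arcs C \<subseteq> arcs D" and bounds: "a \<in> C" "b \<in> C" "C \<subseteq> {a..b}" "D \<subseteq> {a..b}" and "a < b"
  shows "C = D"
proof
  have fin: "finite C" using bounds(3) finite_subset by blast
  show "C \<subseteq> D"
  proof
    fix c assume c: "c \<in> C"
    have "a \<le> c" "c \<le> b" using c bounds by auto
    show "c \<in> D"
    proof (cases "c < b")
      case True
      obtain u v where uv: "(u, v) \<in> arcs C" "u \<le> c" "c < v"
        using ex_arc_over[OF fin c bounds(2) order_refl True] .
      then have "u = c" using c by (auto simp: arcs_def dest!: disjoint_iff[THEN iffD1])
      then show ?thesis using uv assms(1) by (auto simp: arcs_def)
    next
      case False
      then have "c = b" using \<open>c \<le> b\<close> by simp
      \<comment> \<open>No arc starts at the last element \<open>b\<close>; it is reached as the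
        right end of the arc passing over \<open>b - 1\<close>.\<close>
      have "a \<le> b - 1" "b - 1 < b" using \<open>a < b\<close> by auto
      then obtain u v where uv: "(u, v) \<in> arcs C" "u \<le> b - 1" "b - 1 < v"
        using ex_arc_over[OF fin bounds(1,2)] by blast
      then have "v = b" using bounds by (force simp: arcs_def)
      then show ?thesis using uv assms(1) \<open>c = b\<close> by (auto simp: arcs_def)
    qed
  qed
  show "D \<subseteq> C"
  proof
    fix d assume d: "d \<in> D"
    show "d \<in> C"
    proof (rule ccontr)
      assume nd: "d \<notin> C"
      then have "d \<noteq> a" "d \<noteq> b" using bounds by auto
      then have "a \<le> d" "d < b" using bounds(4) d by force+
      then obtain u v where uv: "(u, v) \<in> arcs C" "u \<le> d" "d < v"
        using ex_arc_over[OF fin bounds(1,2)] by blast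
      then have "u < d" using nd by (cases "u = d") (auto simp: arcs_def)
      moreover have "(u, v) \<in> arcs D" using uv assms(1) by blast
      ultimately show False using d uv(3) by (auto simp: arcs_def)
    qed
  qed
qed

lemma doubleton_eq_iff_of_less:
  fixes u v u' v' :: nat
  assumes "u < v" "u' < v'"
  shows "{u, v} = {u', v'} \<longleftrightarrow> u = u' \<and> v = v'"
  using assms by (auto simp: doubleton_eq_iff)

text \<open>The two families of edges differ in length: an arc \<open>(u, v)\<close> has
  \<open>u < v\<close>, so its edge \<open>{u, v + 1}\<close> never joins consecutive vertices. This
  lets arcs and switches be read off the edge set.\<close>

lemma mem_tour_edges_iff:
  assumes "u < v"
  shows "{u, v} \<in> tour_edges n X \<longleftrightarrow>
    v = u + 1 \<and> u \<in> {1..n - 1} - X \<or> u < v - 1 \<and> (u, v - 1) \<in> arcs (switch_closure n X)"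
proof -
  let ?A = "arcs (switch_closure n X)"
  have unit: "{u, v} = {w, w + 1} \<longleftrightarrow> u = w \<and> v = w + 1" for w
    using assms by (intro doubleton_eq_iff_of_less) auto
  have arc: "{u, v} = {w, z + 1} \<and> (w, z) \<in> ?A \<longleftrightarrow> u = w \<and> v = z + 1 \<and> (w, z) \<in> ?A" for w z
  proof (cases "(w, z) \<in> ?A")
    case True
    then have "w < z + 1" using arcsD(3) by fastforce
    then show ?thesis using doubleton_eq_iff_of_less[OF assms, of w "z + 1"] by argo
  qed argo
  have "{u, v} \<in> tour_edges n X \<longleftrightarrow> (\<exists>w. {u, v} = {w, w + 1} \<and> w \<in> {1..n - 1} - X) \<or>
      (\<exists>w z. {u, v} = {w, z + 1} \<and> (w, z) \<in> ?A)"
    by (simp only: tour_edges_def Un_iff mem_Collect_eq)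
  also have "\<dots> \<longleftrightarrow> v = u + 1 \<and> u \<in> {1..n - 1} - X \<or> (\<exists>z. v = z + 1 \<and> (u, z) \<in> ?A)"
    unfolding unit arc by blast
  also have "(\<exists>z. v = z + 1 \<and> (u, z) \<in> ?A) \<longleftrightarrow> u < v - 1 \<and> (u, v - 1) \<in> ?A"
    using arcsD(3)[of u "v - 1" "switch_closure n X"] by force
  finally show ?thesis .
qed

lemma tour_edges_ordered:
  assumes "e \<in> tour_edges n X"
  obtains u v where "u < v" "e = {u, v}"
proof -
  from assms consider u where "e = {u, u + 1}"
    | u v where "e = {u, v + 1}" "(u, v) \<in> arcs (switch_closure n X)"
    unfolding tour_edges_def by blast
  then show thesis
  proof cases
    case 1
    then show ?thesis by (intro that[of u "u + 1"]) auto
  next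
    case 2
    then show ?thesis using arcsD(3)[OF 2(2)] by (intro that[of u "v + 1"]) auto
  qed
qed

lemma arc_edge_iff:
  assumes "u < v"
  shows "{u, v + 1} \<in> tour_edges n X \<longleftrightarrow> (u, v) \<in> arcs (switch_closure n X)"
  using mem_tour_edges_iff[of u "v + 1" n X] assms by auto

lemma unit_edge_iff: "{u, u + 1} \<in> tour_edges n X \<longleftrightarrow> u \<in> {1..n - 1} - X"
  using mem_tour_edges_iff[of u "u + 1" n X] by auto

lemma switch_closure_bounds:
  assumes "n \<ge> 4" "X \<subseteq> {2..n - 2}"
  shows "switch_closure n X \<subseteq> {1..n - 1}" "1 \<in> switch_closure n X" "n - 1 \<in> switch_closure n X"
    "finite (switch_closure n X)" "1 \<notin> X" "n - 1 \<notin> X"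
proof -
  show 1: "switch_closure n X \<subseteq> {1..n - 1}"
    using assms by (fastforce simp: switch_closure_def)
  show "finite (switch_closure n X)" using 1 finite_subset by blast
  show "1 \<notin> X" "n - 1 \<notin> X" using assms by force+
qed (auto simp: switch_closure_def)

context
  fixes n :: nat and X Y :: "nat set"
  assumes n: "n \<ge> 4" and X: "X \<subseteq> {2..n - 2}" and Y: "Y \<subseteq> {2..n - 2}"
begin

text \<open>The edges between consecutive vertices suffice: \<open>u\<close> is a switch exactly
  when \<open>{u, u + 1}\<close> is missing.\<close>

lemma tour_edges_inject: "tour_edges n X = tour_edges n Y \<longleftrightarrow> X = Y"
proof
  assume eq: "tour_edges n X = tour_edges n Y"
  have "u \<in> X \<longleftrightarrow> u \<in> Y" if "u \<in> {1..n - 1}" for u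
    using unit_edge_iff[of u n X] unit_edge_iff[of u n Y] that eq by auto
  moreover have "{2..n - 2} \<subseteq> {1..n - 1}" by auto
  ultimately show "X = Y" using X Y by blast
qed simp

lemma switch_closure_arcs_subset:
  assumes "arcs (switch_closure n X) \<subseteq> arcs (switch_closure n Y)"
  shows "X = Y"
proof -
  have "switch_closure n X = switch_closure n Y"
    using n by (intro arcs_subset_imp_eq[OF assms, of 1 "n - 1"] switch_closure_bounds[OF n X]
        switch_closure_bounds[OF n Y]) auto
  moreover have "X = switch_closure n X - {1, n - 1}" "Y = switch_closure n Y - {1, n - 1}"
    using switch_closure_bounds(5,6)[OF n X] switch_closure_bounds(5,6)[OF n Y]
    by (auto simp: switch_closure_def)
  ultimately show ?thesis by simp
qed

text \<open>No arc passes over the common switch \<open>k\<close>, so an arc starting before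
  \<open>k\<close> ends at \<open>k\<close> at the latest and depends only on the switches up to
  \<open>k\<close>.\<close>

lemma arcs_Int_lessThan:
  assumes "X \<inter> {..<k} = Y \<inter> {..<k}" "k \<in> X" "k \<in> Y" "u < k"
  shows "(u, v) \<in> arcs (switch_closure n X) \<longleftrightarrow> (u, v) \<in> arcs (switch_closure n Y)"
proof -
  have "w \<in> X \<longleftrightarrow> w \<in> Y" if "w \<le> k" for w
    using that assms(1-3) by (cases "w = k") (auto simp: set_eq_iff le_less)
  then have agree: "w \<in> switch_closure n X \<longleftrightarrow> w \<in> switch_closure n Y" if "w \<le> k" for w
    using that unfolding switch_closure_def by blast
  have "k \<in> switch_closure n X" "k \<in> switch_closure n Y"
    using assms(2,3) by (auto simp: switch_closure_def)
  show ?thesis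
  proof (cases "v \<le> k")
    case True
    then have "switch_closure n X \<inter> {u<..<v} = switch_closure n Y \<inter> {u<..<v}" using agree by auto
    then show ?thesis using agree[of u] agree[of v] True \<open>u < k\<close> by (simp add: arcs_def)
  next
    case False
    then have "k \<in> {u<..<v}" using \<open>u < k\<close> by auto
    then show ?thesis
      using \<open>k \<in> switch_closure n X\<close> \<open>k \<in> switch_closure n Y\<close> unfolding arcs_def by blast
  qed
qed

lemma arcs_Int_greaterThan:
  assumes "X \<inter> {k<..} = Y \<inter> {k<..}" "k \<in> X" "k \<in> Y" "k \<le> u"
  shows "(u, v) \<in> arcs (switch_closure n X) \<longleftrightarrow> (u, v) \<in> arcs (switch_closure n Y)"
proof -
  have "w \<in> X \<longleftrightarrow> w \<in> Y" if "w \<ge> k" for w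
    using that assms(1-3) by (cases "w = k") (auto simp: set_eq_iff le_less)
  then have agree: "w \<in> switch_closure n X \<longleftrightarrow> w \<in> switch_closure n Y" if "w \<ge> k" for w
    using that unfolding switch_closure_def by blast
  then have "switch_closure n X \<inter> {u<..<v} = switch_closure n Y \<inter> {u<..<v}"
    using \<open>k \<le> u\<close> by auto
  then show ?thesis using agree[of u] agree[of v] \<open>k \<le> u\<close> by (auto simp: arcs_def)
qed

lemma mem_tour_edges_Int_lessThan:
  assumes "X \<inter> {..<k} = Y \<inter> {..<k}" "k \<in> X" "k \<in> Y" "u < v" "u < k"
  shows "{u, v} \<in> tour_edges n X \<longleftrightarrow> {u, v} \<in> tour_edges n Y"
proof -
  have "u \<in> X \<longleftrightarrow> u \<in> Y" using assms(1,5) by (auto simp: set_eq_iff)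
  then show ?thesis
    by (simp add: mem_tour_edges_iff[OF assms(4)] arcs_Int_lessThan[OF assms(1-3,5)])
qed

lemma mem_tour_edges_Int_greaterThan:
  assumes "X \<inter> {k<..} = Y \<inter> {k<..}" "k \<in> X" "k \<in> Y" "u < v" "k \<le> u"
  shows "{u, v} \<in> tour_edges n X \<longleftrightarrow> {u, v} \<in> tour_edges n Y"
proof -
  have "u \<in> X \<longleftrightarrow> u \<in> Y" using assms(1-3,5) by (cases "u = k") (auto simp: set_eq_iff le_less)
  then show ?thesis
    by (simp add: mem_tour_edges_iff[OF assms(4)] arcs_Int_greaterThan[OF assms(1-3,5)])
qed

end

section \<open>Exchange of tails and third tours\<close>

lemma tour_edges_swap_tails:
  assumes n: "n \<ge> 4" and X: "X \<subseteq> {2..n - 2}" and Y: "Y \<subseteq> {2..n - 2}" and k: "k \<in> X" "k \<in> Y"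
  defines "Z \<equiv> X \<inter> {..k} \<union> Y \<inter> {k<..}" and "W \<equiv> Y \<inter> {..k} \<union> X \<inter> {k<..}"
  shows "charvec (tour_edges n Z) + charvec (tour_edges n W)
       = charvec (tour_edges n X) + charvec (tour_edges n Y)"
proof
  fix e
  have Z: "Z \<subseteq> {2..n - 2}" and W: "W \<subseteq> {2..n - 2}" using X Y unfolding Z_def W_def by auto
  show "(charvec (tour_edges n Z) + charvec (tour_edges n W)) e
      = (charvec (tour_edges n X) + charvec (tour_edges n Y)) e"
  proof (cases "\<exists>u v. u < v \<and> e = {u, v}")
    case False
    then have "e \<notin> tour_edges n V" for V using tour_edges_ordered by metis
    then show ?thesis by (simp add: charvec_def)
  next
    case True
    then obtain u v where e: "u < v" "e = {u, v}" by blast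
    have kk: "k \<in> Z" "k \<in> W" using k by (auto simp: Z_def W_def)
    show ?thesis
    \<comment> \<open>The smaller endpoint decides: edges starting before \<open>k\<close> come from
      the head of a tour, the others from its tail. So the edge \<open>{u, k + 1}\<close> of an arc
      \<open>(u, k)\<close> belongs to the head.\<close>
    proof (cases "u < k")
      case True
      have "e \<in> tour_edges n Z \<longleftrightarrow> e \<in> tour_edges n X" unfolding e(2)
        by (rule mem_tour_edges_Int_lessThan[OF n Z X _ kk(1) k(1) e(1) True]) (auto simp: Z_def)
      moreover have "e \<in> tour_edges n W \<longleftrightarrow> e \<in> tour_edges n Y" unfolding e(2)
        by (rule mem_tour_edges_Int_lessThan[OF n W Y _ kk(2) k(2) e(1) True]) (auto simp: W_def)
      ultimately show ?thesis by (simp add: charvec_def)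
    next
      case False
      then have le: "k \<le> u" by simp
      have "e \<in> tour_edges n Z \<longleftrightarrow> e \<in> tour_edges n Y" unfolding e(2)
        by (rule mem_tour_edges_Int_greaterThan[OF n Z Y _ kk(1) k(2) e(1) le]) (auto simp: Z_def)
      moreover have "e \<in> tour_edges n W \<longleftrightarrow> e \<in> tour_edges n X" unfolding e(2)
        by (rule mem_tour_edges_Int_greaterThan[OF n W X _ kk(2) k(1) e(1) le]) (auto simp: W_def)
      ultimately show ?thesis by (simp add: charvec_def)
    qed
  qed
qed

text \<open>Along the arcs of \<open>T\<close> from the one that is missing in \<open>Y\<close> to the one that is missing in
  \<open>X\<close>, the switch \<open>k\<close> is the last endpoint reached by an arc of \<open>X\<close>.\<close>

lemma ex_common_switch_ordered:
  assumes n: "n \<ge> 4" and X: "X \<subseteq> {2..n - 2}" and Y: "Y \<subseteq> {2..n - 2}" and T: "T \<subseteq> {2..n - 2}"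
    and sub: "arcs (switch_closure n T) \<subseteq> arcs (switch_closure n X) \<union> arcs (switch_closure n Y)"
    and a: "(a, a') \<in> arcs (switch_closure n T)" "(a, a') \<notin> arcs (switch_closure n Y)"
    and b: "(b, b') \<in> arcs (switch_closure n T)" "(b, b') \<notin> arcs (switch_closure n X)"
    and "a < b"
  shows "\<exists>k \<in> X \<inter> Y. X \<inter> {..<k} \<noteq> Y \<inter> {..<k} \<and> X \<inter> {k<..} \<noteq> Y \<inter> {k<..}"
proof -
  let ?T = "switch_closure n T" and ?X = "switch_closure n X" and ?Y = "switch_closure n Y"
  let ?M = "{s \<in> ?T. a < s \<and> s \<le> b \<and> (\<exists>r. (r, s) \<in> arcs ?X)}"
  note T' = switch_closure_bounds[OF n T]
  define k where "k = Max ?M"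
  have aX: "(a, a') \<in> arcs ?X" and bY: "(b, b') \<in> arcs ?Y"
    using subsetD[OF sub a(1)] subsetD[OF sub b(1)] a(2) b(2) by simp_all
  have bT: "b \<in> ?T" "b' \<in> ?T" "b < b'" using arcsD(1-3)[OF b(1)] by simp_all
  have "a' \<le> b" using arcsD(4)[OF a(1) bT(1)] \<open>a < b\<close> by simp
  \<comment> \<open>The set is nonempty: the arc \<open>(a, a')\<close> is missing in
    \<open>Y\<close>, hence belongs to \<open>X\<close>, and it ends before or at
    \<open>b\<close>.\<close>
  then have "a' \<in> ?M" using arcsD(2,3)[OF a(1)] aX by auto
  moreover have fin: "finite ?M" using T'(4) by simp
  ultimately have kM: "k \<in> ?M" unfolding k_def using Max_in[OF fin] by blast
  then have k: "k \<in> ?T" "a < k" "k \<le> b" by simp_all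
  obtain r where "(r, k) \<in> arcs ?X" using kM by blast
  then have kX: "k \<in> ?X" by (rule arcsD(2))
  \<comment> \<open>If \<open>k = b\<close>, the arc \<open>(b, b')\<close> of \<open>Y\<close>
    starts at \<open>k\<close>. Otherwise the arc of \<open>T\<close> leaving \<open>k\<close> still
    ends at most at \<open>b\<close>; by maximality of \<open>k\<close> it is not an arc of
    \<open>X\<close>, so it is one of \<open>Y\<close>.\<close>
  have "k \<in> ?Y"
  proof (cases "k = b")
    case True
    then show ?thesis using arcsD(1)[OF bY] by simp
  next
    case False
    then obtain u v where uv: "(u, v) \<in> arcs ?T" "u \<le> k" "k < v"
      using ex_arc_over[OF T'(4) k(1) bT(1), of k] k(3) by auto
    have u: "u = k" using arcsD(4)[OF uv(1) k(1)] uv by simp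
    have v: "v \<le> b" "v \<in> ?T" using arcsD(4)[OF uv(1) bT(1)] arcsD(2)[OF uv(1)] u k(3) False by auto
    have "(u, v) \<notin> arcs ?X"
    proof
      assume "(u, v) \<in> arcs ?X"
      then have "v \<in> ?M" using v uv(3) k(2) by auto
      then have "v \<le> k" unfolding k_def by (rule Max_ge[OF fin])
      then show False using uv(3) by simp
    qed
    then have "(u, v) \<in> arcs ?Y" using subsetD[OF sub uv(1)] by simp
    then show ?thesis unfolding u by (rule arcsD(1))
  qed
  moreover have "k \<noteq> 1" "k \<noteq> n - 1"
  proof -
    have "a \<ge> 1" "b' \<le> n - 1" using T'(1) arcsD(1)[OF a(1)] bT(2) by auto
    then show "k \<noteq> 1" "k \<noteq> n - 1" using k(2,3) bT(3) by auto
  qed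
  ultimately have kXY: "k \<in> X" "k \<in> Y" using kX by (auto simp: switch_closure_def)
  \<comment> \<open>Agreement below \<open>k\<close> would carry the arc \<open>(a, a')\<close> from
    \<open>X\<close> to \<open>Y\<close>; agreement above \<open>k\<close> would carry
    \<open>(b, b')\<close> from \<open>Y\<close> to \<open>X\<close>.\<close>
  then have "X \<inter> {..<k} \<noteq> Y \<inter> {..<k}" "X \<inter> {k<..} \<noteq> Y \<inter> {k<..}"
    using arcs_Int_lessThan[OF n X Y _ kXY k(2), of a'] arcs_Int_greaterThan[OF n X Y _ kXY k(3), of b']
      aX a(2) bY b(2) by metis+
  with kXY show ?thesis by blast
qed

text \<open>By \<open>switch_closure_arcs_subset\<close> the third tour has an arc missing in
  \<open>Y\<close> and one missing in \<open>X\<close>. They start at different points, and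
  whichever comes first fixes the roles of \<open>X\<close> and \<open>Y\<close>, in which the
  conclusion is symmetric.\<close>

lemma ex_common_switch:
  assumes n: "n \<ge> 4" and X: "X \<subseteq> {2..n - 2}" and Y: "Y \<subseteq> {2..n - 2}" and T: "T \<subseteq> {2..n - 2}"
    and sub: "tour_edges n T \<subseteq> tour_edges n X \<union> tour_edges n Y" and "T \<noteq> X" "T \<noteq> Y"
  shows "\<exists>k \<in> X \<inter> Y. X \<inter> {..<k} \<noteq> Y \<inter> {..<k} \<and> X \<inter> {k<..} \<noteq> Y \<inter> {k<..}"
proof -
  let ?T = "switch_closure n T" and ?X = "switch_closure n X" and ?Y = "switch_closure n Y"
  have sub': "arcs ?T \<subseteq> arcs ?X \<union> arcs ?Y"
  proof clarify
    fix u v assume uv: "(u, v) \<in> arcs ?T" "(u, v) \<notin> arcs ?Y"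
    then have "u < v" by (simp add: arcs_def)
    then have "{u, v + 1} \<in> tour_edges n T" "{u, v + 1} \<notin> tour_edges n Y"
      using uv by (simp_all only: arc_edge_iff not_False_eq_True)
    then have "{u, v + 1} \<in> tour_edges n X" using sub by blast
    then show "(u, v) \<in> arcs ?X" using \<open>u < v\<close> by (simp only: arc_edge_iff)
  qed
  obtain a a' where a: "(a, a') \<in> arcs ?T" "(a, a') \<notin> arcs ?Y"
    using switch_closure_arcs_subset[OF n T Y] \<open>T \<noteq> Y\<close> by (meson subrelI)
  obtain b b' where b: "(b, b') \<in> arcs ?T" "(b, b') \<notin> arcs ?X"
    using switch_closure_arcs_subset[OF n T X] \<open>T \<noteq> X\<close> by (meson subrelI)
  \<comment> \<open>Two arcs of \<open>T\<close> with the same start coincide, and this arc would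
    then be in neither \<open>X\<close> nor \<open>Y\<close>.\<close>
  have "a \<noteq> b"
  proof
    assume "a = b"
    then have "a' = b'"
      using arcsD(4)[OF a(1), of b'] arcsD(4)[OF b(1), of a'] arcsD(2,3)[OF a(1)] arcsD(2,3)[OF b(1)]
      by auto
    then show False using subsetD[OF sub' a(1)] a(2) b(2) \<open>a = b\<close> by simp
  qed
  then consider "a < b" | "b < a" by linarith
  then show ?thesis
  proof cases
    case 1
    then show ?thesis using ex_common_switch_ordered[OF n X Y T sub' a b] by blast
  next
    case 2
    then show ?thesis using ex_common_switch_ordered[OF n Y X T _ b a] sub' by blast
  qed
qed

lemma not_adjacent_tour_edges_iff:
  assumes n: "n \<ge> 4" and X: "X \<subseteq> {2..n - 2}" and Y: "Y \<subseteq> {2..n - 2}"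
  shows "\<not> adjacent_vertices (convex hull (charvec ` tour_edges n ` Pow {2..n - 2}))
      (charvec (tour_edges n X)) (charvec (tour_edges n Y)) \<longleftrightarrow>
    (\<exists>k \<in> X \<inter> Y. X \<inter> {..<k} \<noteq> Y \<inter> {..<k} \<and> X \<inter> {k<..} \<noteq> Y \<inter> {k<..})"
proof
  let ?F = "tour_edges n ` Pow {2..n - 2}"
  have XY: "tour_edges n X \<in> ?F" "tour_edges n Y \<in> ?F" using X Y by auto
  {
    assume nadj: "\<not> adjacent_vertices (convex hull (charvec ` ?F))
      (charvec (tour_edges n X)) (charvec (tour_edges n Y))"
    show "\<exists>k \<in> X \<inter> Y. X \<inter> {..<k} \<noteq> Y \<inter> {..<k} \<and> X \<inter> {k<..} \<noteq> Y \<inter> {k<..}"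
    proof (rule ccontr)
      assume no: "\<not> ?thesis"
      have "t = tour_edges n X \<or> t = tour_edges n Y"
        if t: "t \<in> ?F" "t \<subseteq> tour_edges n X \<union> tour_edges n Y" for t
      proof -
        obtain T where T: "T \<subseteq> {2..n - 2}" and t_eq: "t = tour_edges n T" using t(1) by blast
        have "T = X \<or> T = Y" using ex_common_switch[OF n X Y T] t(2) no unfolding t_eq by metis
        then show ?thesis unfolding t_eq by metis
      qed
      then have "adjacent_vertices (convex hull (charvec ` ?F))
          (charvec (tour_edges n X)) (charvec (tour_edges n Y))"
        by (rule adjacent_verticesI_subset_Un[OF XY])
      then show False using nadj by simp
    qed
  }
  assume "\<exists>k \<in> X \<inter> Y. X \<inter> {..<k} \<noteq> Y \<inter> {..<k} \<and> X \<inter> {k<..} \<noteq> Y \<inter> {k<..}"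
  then obtain k where k: "k \<in> X" "k \<in> Y" "X \<inter> {..<k} \<noteq> Y \<inter> {..<k}" "X \<inter> {k<..} \<noteq> Y \<inter> {k<..}"
    by blast
  let ?Z = "X \<inter> {..k} \<union> Y \<inter> {k<..}" and ?W = "Y \<inter> {..k} \<union> X \<inter> {k<..}"
  have ZW: "?Z \<subseteq> {2..n - 2}" "?W \<subseteq> {2..n - 2}" using X Y by auto
  \<comment> \<open>The exchanged tour differs from \<open>X\<close> above \<open>k\<close> and from
    \<open>Y\<close> below \<open>k\<close>, so it is a new one.\<close>
  have "?Z \<inter> {k<..} = Y \<inter> {k<..}" "?Z \<inter> {..<k} = X \<inter> {..<k}" by auto
  then have "?Z \<noteq> X" "?Z \<noteq> Y" using k by auto
  then have "tour_edges n ?Z \<noteq> tour_edges n X" "tour_edges n ?Z \<noteq> tour_edges n Y"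
    using tour_edges_inject[OF n ZW(1) X] tour_edges_inject[OF n ZW(1) Y] by auto
  then show "\<not> adjacent_vertices (convex hull (charvec ` ?F))
      (charvec (tour_edges n X)) (charvec (tour_edges n Y))"
    using ZW by (intro not_adjacent_verticesI[OF _ _ tour_edges_swap_tails[OF n X Y k(1,2)]]) auto
qed

subsection \<open>Switches of pyramidal tours\<close>

definition switches :: "nat \<Rightarrow> nat set \<Rightarrow> nat set" where
  "switches n I = {k \<in> {2..n - 2}. (k \<in> I) \<noteq> (k + 1 \<in> I)}"

section \<open>Edges of a tour, from its two parts to its switches\<close>

fun path_edges :: "nat list \<Rightarrow> nat set set" where
  "path_edges (x # y # zs) = insert {x, y} (path_edges (y # zs))"
| "path_edges _ = {}"

lemma path_edges_conv_nth: "path_edges l = {{l ! i, l ! (i + 1)} | i. i + 1 < length l}"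
proof (induction l rule: path_edges.induct)
  case (1 x y zs)
  have "{{(x # y # zs) ! i, (x # y # zs) ! (i + 1)} | i. i + 1 < length (x # y # zs)}
      = (\<lambda>i. {(x # y # zs) ! i, (x # y # zs) ! (i + 1)}) ` {..<Suc (length zs)}"
    by auto
  also have "\<dots> = insert {x, y} ((\<lambda>i. {(y # zs) ! i, (y # zs) ! (i + 1)}) ` {..<length zs})"
    unfolding lessThan_Suc_eq_insert_0 image_insert image_image by simp
  also have "(\<lambda>i. {(y # zs) ! i, (y # zs) ! (i + 1)}) ` {..<length zs} = path_edges (y # zs)"
    unfolding 1 by auto
  finally show ?case by simp
qed auto

lemma path_edges_append: "path_edges (l @ x # m) = path_edges (l @ [x]) \<union> path_edges (x # m)"
  by (induction l rule: path_edges.induct) (auto simp: neq_Nil_conv)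

lemma path_edges_rev: "path_edges (rev l) = path_edges l"
proof (induction l rule: path_edges.induct)
  case (1 x y zs)
  have "path_edges (rev (x # y # zs)) = path_edges (rev zs @ y # [x])" by simp
  also have "\<dots> = path_edges (rev (y # zs)) \<union> {{y, x}}"
    using path_edges_append[of "rev zs" y "[x]"] by simp
  also have "\<dots> = path_edges (x # y # zs)" unfolding 1 by (simp add: insert_commute)
  finally show ?case .
qed simp_all

text \<open>Repeating the first vertex at the end replaces the index modulo the length, and the
  closed path can then be cut at \<open>n\<close>.\<close>

lemma cycle_edges_eq_path_edges: "cycle_edges (x # zs) = path_edges (x # zs @ [x])"
proof -
  let ?l = "x # zs"
  have "{?l ! i, ?l ! ((i + 1) mod length ?l)} = {(?l @ [x]) ! i, (?l @ [x]) ! (i + 1)}"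
    if "i < length ?l" for i
  proof -
    have "?l ! i = (?l @ [x]) ! i" using that by (simp only: nth_append if_True)
    moreover have "?l ! ((i + 1) mod length ?l) = (?l @ [x]) ! (i + 1)"
    proof (cases "i + 1 = length ?l")
      case True
      then show ?thesis by (simp only: mod_self nth_append_length nth_Cons_0)
    next
      case False
      then have "i + 1 < length ?l" using that by simp
      then show ?thesis by (simp only: mod_less nth_append if_True)
    qed
    ultimately show ?thesis by simp
  qed
  then show ?thesis unfolding cycle_edges_def
    using path_edges_conv_nth[of "?l @ [x]"] by (simp only: append_Cons length_append) fastforce
qed

lemma path_edges_sorted:
  assumes "sorted_wrt (<) l"
  shows "path_edges l = {{u, v} | u v. (u, v) \<in> arcs (set l)}"
  using assms
proof (induction l rule: path_edges.induct)
  case (1 x y zs)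
  let ?S = "set (y # zs)"
  have lt: "x < w" if "w \<in> ?S" for w using 1(2) that by force
  have ge: "y \<le> w" if "w \<in> ?S" for w using 1(2) that by auto
  have "arcs (insert x ?S) = insert (x, y) (arcs ?S)"
  proof (intro set_eqI iffI; clarify)
    fix u v assume uv: "(u, v) \<in> arcs (insert x ?S)" "(u, v) \<notin> arcs ?S"
    note D = arcsD[OF uv(1)]
    have "v \<in> ?S" using D(1-3) lt by force
    have "u = x"
    proof (rule ccontr)
      assume "u \<noteq> x"
      then have "(u, v) \<in> arcs ?S" using uv(1) \<open>v \<in> ?S\<close> unfolding arcs_def by blast
      with uv show False by simp
    qed
    moreover have "v = y" using D(4)[of y] ge[OF \<open>v \<in> ?S\<close>] lt[of y] \<open>u = x\<close> by simp
    ultimately show "u = x \<and> v = y" ..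
  next
    fix u v assume "(u, v) \<in> insert (x, y) (arcs ?S)"
    then show "(u, v) \<in> arcs (insert x ?S)"
    proof
      assume "(u, v) = (x, y)"
      then show ?thesis using lt ge by (force simp: arcs_def)
    next
      assume uv: "(u, v) \<in> arcs ?S"
      note D = arcsD[OF uv]
      have "insert x ?S \<inter> {u<..<v} = ?S \<inter> {u<..<v}" using lt[OF D(1)] by auto
      then show ?thesis using uv unfolding arcs_def by simp
    qed
  qed
  then show ?case using 1 by auto
qed (auto simp: arcs_def)

text \<open>A long jump of one part passes over a maximal run \<open>u + 1, \<dots>, v - 1\<close>
  of the other part. Such runs begin just after a switch or after \<open>1\<close>, and end at a
  switch or at \<open>n - 1\<close>. The condition on \<open>u + 1\<close> tells which part makes
  the jump.\<close>

lemma arcs_class_iff: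
  assumes n: "n \<ge> 4" and I: "I \<subseteq> {2..n - 1}" and uv: "u + 1 < v"
  shows "(u, v) \<in> arcs (insert 1 (insert n I)) \<longleftrightarrow>
    (u, v - 1) \<in> arcs (switch_closure n (switches n I)) \<and> u + 1 \<notin> I"
proof
  let ?A = "insert 1 (insert n I)" and ?S = "switches n I"
  have "{2..n - 1} \<subseteq> {1..n}" by auto
  then have "I \<subseteq> {1..n}" by (rule subset_trans[OF I])
  then have A: "?A \<subseteq> {1..n}" using n by simp
  assume a: "(u, v) \<in> arcs ?A"
  note D = arcsD[OF a]
  have bounds: "1 \<le> u" "v \<le> n" using D(1,2) A by auto
  have out: "w \<notin> I" if "u < w" "w < v" for w using D(4)[of w] that by auto
  have "u + 1 \<notin> I" using out uv by simp
  moreover have "u \<in> switch_closure n ?S"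
  proof (cases "u = 1")
    case False
    then have "u \<in> I" "u \<in> {2..n - 2}" using D(1) bounds uv by auto
    then show ?thesis using \<open>u + 1 \<notin> I\<close> by (simp add: switch_closure_def switches_def)
  qed (simp add: switch_closure_def)
  moreover have "v - 1 \<in> switch_closure n ?S"
  proof (cases "v = n")
    case False
    then have "v \<in> I" "v - 1 \<in> {2..n - 2}" "v - 1 + 1 = v" "v - 1 \<notin> I"
      using D(2) bounds uv out[of "v - 1"] by auto
    then show ?thesis by (simp add: switch_closure_def switches_def)
  qed (simp add: switch_closure_def)
  moreover have "switch_closure n ?S \<inter> {u<..<v - 1} = {}"
  proof (intro equals0I)
    fix s assume s: "s \<in> switch_closure n ?S \<inter> {u<..<v - 1}"
    then have "s \<in> ?S" using bounds by (auto simp: switch_closure_def)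
    then have "s \<in> I \<or> s + 1 \<in> I" by (auto simp: switches_def)
    moreover have "u < s" "s + 1 < v" using s by (auto simp: less_diff_conv)
    ultimately show False using out[of s] out[of "s + 1"] by auto
  qed
  ultimately show "(u, v - 1) \<in> arcs (switch_closure n ?S) \<and> u + 1 \<notin> I"
    using uv unfolding arcs_def by simp
next
  let ?A = "insert 1 (insert n I)" and ?S = "switches n I"
  assume "(u, v - 1) \<in> arcs (switch_closure n ?S) \<and> u + 1 \<notin> I"
  then have a: "(u, v - 1) \<in> arcs (switch_closure n ?S)" and u1: "u + 1 \<notin> I" by simp_all
  note D = arcsD[OF a]
  have "?S \<subseteq> {2..n - 2}" by (auto simp: switches_def)
  note C = switch_closure_bounds[OF n this]
  have bounds: "1 \<le> u" "v - 1 \<le> n - 1" using C(1) D(1,2) by auto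
  \<comment> \<open>No switch lies strictly between \<open>u\<close> and \<open>v - 1\<close>, so
    membership in \<open>I\<close> is constant along the run, starting from
    \<open>u + 1\<close>.\<close>
  have out: "w \<notin> I" if "u + 1 \<le> w" "w < v" for w
    using that
  proof (induction w rule: dec_induct)
    case base
    show ?case by (fact u1)
  next
    case (step w)
    have "w \<notin> ?S"
    proof
      assume "w \<in> ?S"
      then have "w \<in> switch_closure n ?S" by (simp add: switch_closure_def)
      then show False using D(4)[of w] step by simp
    qed
    moreover have "w \<in> {2..n - 2}" using step bounds by auto
    ultimately show ?case using step by (simp add: switches_def)
  qed
  have "u \<in> ?A"
  proof (cases "u = 1")
    case False
    then have "u \<in> ?S" using D(1) uv bounds by (auto simp: switch_closure_def)
    then show ?thesis using u1 by (auto simp: switches_def)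
  qed simp
  moreover have "v \<in> ?A"
  proof (cases "v = n")
    case False
    then have "v - 1 \<in> ?S" using D(2) uv bounds by (auto simp: switch_closure_def)
    then have "v - 1 + 1 \<in> I" using out[of "v - 1"] uv by (auto simp: switches_def)
    then show ?thesis using uv by simp
  qed simp
  moreover have "?A \<inter> {u<..<v} = {}"
    using out bounds uv by fastforce
  ultimately show "(u, v) \<in> arcs ?A" using uv by (simp add: arcs_def)
qed

lemma switches_complement: "switches n ({2..n - 1} - I) = switches n I"
proof -
  have "k \<in> {2..n - 1} \<and> k + 1 \<in> {2..n - 1}" if "k \<in> {2..n - 2}" for k using that by auto
  then show ?thesis unfolding switches_def by blast
qed

lemma arcs_classes_eq_tour_edges:
  assumes n: "n \<ge> 4" and I: "I \<subseteq> {2..n - 1}"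
  defines "A \<equiv> insert 1 (insert n I)" and "B \<equiv> insert 1 (insert n ({2..n - 1} - I))"
  shows "{{u, v} | u v. (u, v) \<in> arcs A} \<union> {{u, v} | u v. (u, v) \<in> arcs B}
    = tour_edges n (switches n I)"
proof -
  have iff: "(u, v) \<in> arcs A \<or> (u, v) \<in> arcs B \<longleftrightarrow> {u, v} \<in> tour_edges n (switches n I)"
    if uv: "u < v" for u v
  proof (cases "v = u + 1")
    case True
    have "(u, v) \<in> arcs C \<longleftrightarrow> u \<in> C \<and> u + 1 \<in> C" for C
      unfolding arcs_def True by auto
    then have "(u, v) \<in> arcs A \<or> (u, v) \<in> arcs B \<longleftrightarrow> u \<in> A \<and> u + 1 \<in> A \<or> u \<in> B \<and> u + 1 \<in> B"
      by simp
    also have "\<dots> \<longleftrightarrow> u \<in> {1..n - 1} - switches n I"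
    proof -
      \<comment> \<open>The vertices \<open>1\<close> and \<open>n\<close> belong to both
        \<open>A\<close> and \<open>B\<close>, so \<open>{1, 2}\<close> and
        \<open>{n - 1, n}\<close> always occur; this matches the range \<open>{2..n - 2}\<close> of
        switches.\<close>
      consider "u = 0" | "u = 1" | "u \<in> {2..n - 2}" | "u = n - 1" | "u \<ge> n" by force
      then show ?thesis
      proof cases
        case 3
        then have "u \<noteq> 0" "u \<noteq> 1" "u \<noteq> n" "u + 1 \<noteq> 1" "u + 1 \<noteq> n" "u \<in> {1..n - 1}" "u \<in> {2..n - 1}" "u + 1 \<in> {2..n - 1}"
          by auto
        then show ?thesis using 3 unfolding A_def B_def switches_def by blast
      qed (use n I in \<open>auto simp: A_def B_def switches_def\<close>)
    qed
    also have "\<dots> \<longleftrightarrow> {u, v} \<in> tour_edges n (switches n I)"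
      unfolding True unit_edge_iff ..
    finally show ?thesis .
  next
    case False
    then have lt: "u + 1 < v" using uv by simp
    \<comment> \<open>The last conjunct always holds: \<open>u + 1\<close> cannot lie in both parts,
      so one of them makes the jump.\<close>
    have "(u, v) \<in> arcs A \<or> (u, v) \<in> arcs B \<longleftrightarrow> (u, v - 1) \<in> arcs (switch_closure n (switches n I))
       \<and> (u + 1 \<notin> I \<or> u + 1 \<notin> {2..n - 1} - I)"
      unfolding A_def B_def arcs_class_iff[OF n I lt] arcs_class_iff[OF n Diff_subset lt] switches_complement
      by blast
    also have "\<dots> \<longleftrightarrow> {u, v} \<in> tour_edges n (switches n I)"
      using mem_tour_edges_iff[OF uv, of n "switches n I"] lt by auto
    finally show ?thesis .
  qed
  show ?thesis
  proof (intro set_eqI iffI)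
    fix e assume "e \<in> {{u, v} | u v. (u, v) \<in> arcs A} \<union> {{u, v} | u v. (u, v) \<in> arcs B}"
    then obtain u v where e: "e = {u, v}" "(u, v) \<in> arcs A \<or> (u, v) \<in> arcs B" by blast
    then show "e \<in> tour_edges n (switches n I)" using iff arcsD(3) by metis
  next
    fix e assume e: "e \<in> tour_edges n (switches n I)"
    then obtain u v where "u < v" "e = {u, v}" by (rule tour_edges_ordered)
    then show "e \<in> {{u, v} | u v. (u, v) \<in> arcs A} \<union> {{u, v} | u v. (u, v) \<in> arcs B}"
      using e iff by blast
  qed
qed

section \<open>Pyramidal tours as sets of switches\<close>

lemma cycle_edges_pyramidal:
  assumes n: "n \<ge> 4" and as: "sorted_wrt (<) as" "set as \<subseteq> {2..n - 1}"
    and bs: "sorted_wrt (>) bs" "set bs = {2..n - 1} - set as"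
  shows "cycle_edges ([1] @ as @ [n] @ bs) = tour_edges n (switches n (set as))"
proof -
  let ?up = "1 # as @ [n]" and ?down = "1 # rev bs @ [n]"
  \<comment> \<open>Cut at \<open>n\<close> and read backwards, the descending half is increasing
    too, so both halves consist of arcs.\<close>
  have "path_edges (1 # (as @ n # bs) @ [1]) = path_edges ((1 # as) @ n # (bs @ [1]))" by simp
  also have "\<dots> = path_edges ?up \<union> path_edges (rev ?down)"
    using path_edges_append[of "1 # as" n "bs @ [1]"] by simp
  also have "\<dots> = path_edges ?up \<union> path_edges ?down" unfolding path_edges_rev ..
  also have "path_edges ?up = {{u, v} | u v. (u, v) \<in> arcs (set ?up)}"
    using n as by (intro path_edges_sorted) (fastforce simp: sorted_wrt_append)
  also have "path_edges ?down = {{u, v} | u v. (u, v) \<in> arcs (set ?down)}"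
    using n bs by (intro path_edges_sorted) (fastforce simp: sorted_wrt_append sorted_wrt_rev)
  also have "set ?up = insert 1 (insert n (set as))" by auto
  also have "set ?down = insert 1 (insert n ({2..n - 1} - set as))" using bs(2) by auto
  also note arcs_classes_eq_tour_edges[OF n as(2)]
  finally show ?thesis using cycle_edges_eq_path_edges[of 1 "as @ n # bs"] by simp
qed

lemma pyr_list_code:
  assumes n: "n \<ge> 4" and "pyr_list n xs"
  shows "incr_part n xs \<subseteq> {2..n - 1}" "2 \<in> incr_part n xs"
    "cycle_edges xs = tour_edges n (switches n (incr_part n xs))"
proof -
  obtain as bs where xs: "xs = [1] @ as @ [n] @ bs" and sorted: "sorted_wrt (<) as" "sorted_wrt (>) bs"
    and dist: "distinct xs" and set: "set xs = {1..n}"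
    using assms unfolding pyr_list_def by blast
  have as_bs: "set as \<union> set bs = {2..n - 1}"
  proof -
    have "set as \<union> set bs = set xs - {1, n}" using dist unfolding xs by auto
    also have "\<dots> = {2..n - 1}" unfolding set using n by auto
    finally show ?thesis .
  qed
  have disj: "set as \<inter> set bs = {}" and nas: "n \<notin> set as" using dist unfolding xs by auto
  have as: "set as \<subseteq> {2..n - 1}" and bs: "set bs = {2..n - 1} - set as" using as_bs disj by auto
  have tw: "takeWhile (\<lambda>v. v \<noteq> n) (as @ n # bs) = as" "dropWhile (\<lambda>v. v \<noteq> n) (as @ n # bs) = n # bs"
    using nas by (auto simp: takeWhile_append dropWhile_append)
  have I: "incr_part n xs = (if 2 \<in> set as then set as else set bs)"
    unfolding incr_part_def xs Let_def by (simp add: tw)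
  have two: "2 \<in> set as \<union> set bs" unfolding as_bs using n by simp
  show "incr_part n xs \<subseteq> {2..n - 1}" "2 \<in> incr_part n xs" using I as bs two by auto
  have "cycle_edges xs = tour_edges n (switches n (set as))"
    unfolding xs using cycle_edges_pyramidal[OF n sorted(1) as sorted(2) bs] .
  \<comment> \<open>Reorienting the tour replaces a part by its complement, which has the same
    switches.\<close>
  moreover have "switches n (incr_part n xs) = switches n (set as)"
    unfolding I using switches_complement[of n "set as"] bs by simp
  ultimately show "cycle_edges xs = tour_edges n (switches n (incr_part n xs))" by simp
qed

text \<open>Walking upwards, each element of \<open>X\<close> flips the part, so the parity of the
  number of elements of \<open>X\<close> below \<open>i\<close> is a suitable choice.\<close>

lemma ex_switches_eq:
  assumes X: "X \<subseteq> {2..n - 2}"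
  shows "\<exists>I \<subseteq> {2..n - 1}. switches n I = X"
proof -
  let ?I = "{i \<in> {2..n - 1}. even (card (X \<inter> {..<i}))}"
  have "k \<in> switches n ?I \<longleftrightarrow> k \<in> X" if k: "k \<in> {2..n - 2}" for k
  proof -
    have mem: "k \<in> {2..n - 1}" "k + 1 \<in> {2..n - 1}" using k by auto
    have "card (X \<inter> {..<k + 1}) = card (X \<inter> {..<k}) + (if k \<in> X then 1 else 0)"
      by (auto simp: lessThan_Suc Int_insert_right)
    then show ?thesis using k mem by (auto simp: switches_def)
  qed
  moreover have "switches n ?I \<subseteq> {2..n - 2}" by (auto simp: switches_def)
  ultimately have "switches n ?I = X" using X by blast
  then show ?thesis by (intro exI[of _ ?I]) auto
qed

lemma PT_eq:
  assumes n: "n \<ge> 4"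
  shows "PT n = tour_edges n ` Pow {2..n - 2}"
proof (intro subset_antisym subsetI)
  fix t assume "t \<in> PT n"
  then obtain xs where "pyr_list n xs" "t = cycle_edges xs" unfolding PT_def by blast
  then have "t = tour_edges n (switches n (incr_part n xs))" using pyr_list_code(3)[OF n] by simp
  moreover have "switches n (incr_part n xs) \<in> Pow {2..n - 2}" by (auto simp: switches_def)
  ultimately show "t \<in> tour_edges n ` Pow {2..n - 2}" by (rule image_eqI)
next
  fix t assume "t \<in> tour_edges n ` Pow {2..n - 2}"
  then obtain X where X: "X \<subseteq> {2..n - 2}" "t = tour_edges n X" by blast
  then obtain I where I: "I \<subseteq> {2..n - 1}" "switches n I = X" using ex_switches_eq by blast
  let ?as = "sorted_list_of_set I" and ?bs = "rev (sorted_list_of_set ({2..n - 1} - I))"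
  have fin: "finite I" using I(1) finite_subset by blast
  then have set: "set ?as = I" "set ?bs = {2..n - 1} - I" by simp_all
  have sorted: "sorted_wrt (<) ?as" "sorted_wrt (>) ?bs"
    using strict_sorted_list_of_set by (simp_all add: sorted_wrt_rev)
  let ?xs = "[1] @ ?as @ [n] @ ?bs"
  have "insert 1 (insert n {2..n - 1}) = {1..n}" using n by auto
  then have "set ?xs = {1..n}" unfolding set_append set using I(1) by auto
  moreover have "distinct ?xs"
    using n subsetD[OF I(1), of 1] subsetD[OF I(1), of n] fin by auto
  ultimately have "pyr_list n ?xs" unfolding pyr_list_def using sorted by blast
  moreover have "cycle_edges ?xs = t"
    using cycle_edges_pyramidal[OF n sorted(1) _ sorted(2), unfolded set, OF I(1) refl] I(2) X(2) by simp
  ultimately show "t \<in> PT n" unfolding PT_def by blast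
qed

section \<open>Translation into conditions on the codes\<close>

lemma switches_agree_iff:
  fixes P Q :: "nat \<Rightarrow> bool"
  assumes "a \<le> b"
  shows "(\<forall>i \<in> {a..<b}. (P i \<noteq> P (i + 1)) = (Q i \<noteq> Q (i + 1)))
    \<longleftrightarrow> (\<forall>j \<in> {a..b}. (P j = Q j) = (P a = Q a))"
  using assms
proof (induction b rule: dec_induct)
  case (step b)
  \<comment> \<open>\<open>?S i\<close> says that the truth value of \<open>P j = Q j\<close> is the
    same for \<open>j = i\<close> and \<open>j = i + 1\<close>; over an interval this means that it
    is constant.\<close>
  let ?S = "\<lambda>i. (P i \<noteq> P (i + 1)) = (Q i \<noteq> Q (i + 1))" and ?T = "\<lambda>j. (P j = Q j) = (P a = Q a)"
  have 1: "(\<forall>i \<in> {a..<Suc b}. ?S i) \<longleftrightarrow> ?S b \<and> (\<forall>i \<in> {a..<b}. ?S i)"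
    using step.hyps by (simp add: atLeastLessThanSuc)
  have 2: "(\<forall>j \<in> {a..Suc b}. ?T j) \<longleftrightarrow> ?T (Suc b) \<and> (\<forall>j \<in> {a..b}. ?T j)"
    using step.hyps by (simp add: atLeastAtMostSuc_conv)
  show ?case
  proof (cases "\<forall>j \<in> {a..b}. ?T j")
    case True
    then have "?T b" by (rule bspec) (use step.hyps in simp)
    then have "?S b \<longleftrightarrow> ?T (Suc b)" unfolding Suc_eq_plus1 by argo
    then show ?thesis unfolding 1 2 step.IH by (rule arg_cong)
  next
    case False
    then show ?thesis unfolding 1 2 step.IH by (simp only: simp_thms)
  qed
qed simp

text \<open>Both sets contain the vertex 2, so the constant value of the agreement on
  \<open>{2..k}\<close> can only be true.\<close>

lemma switches_lessThan_eq_iff: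
  assumes "k \<in> {2..n - 2}" "2 \<in> I" "2 \<in> J"
  shows "switches n I \<inter> {..<k} = switches n J \<inter> {..<k} \<longleftrightarrow> (\<forall>i \<in> {3..k}. i \<in> I \<longleftrightarrow> i \<in> J)"
proof -
  have "switches n I \<inter> {..<k} = switches n J \<inter> {..<k} \<longleftrightarrow>
      (\<forall>i \<in> {2..<k}. ((i \<in> I) \<noteq> (i + 1 \<in> I)) = ((i \<in> J) \<noteq> (i + 1 \<in> J)))"
    using assms(1) unfolding switches_def set_eq_iff by fastforce
  also have "\<dots> \<longleftrightarrow> (\<forall>j \<in> {2..k}. (j \<in> I) = (j \<in> J))"
    using switches_agree_iff[of 2 k "\<lambda>i. i \<in> I" "\<lambda>i. i \<in> J"] assms by simp
  also have "{2..k} = insert 2 {3..k}" using assms(1) by auto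
  finally show ?thesis using assms by simp
qed

text \<open>Above \<open>k\<close> no vertex is fixed in advance, so agreement and disagreement
  throughout are both possible; \<open>k + 1\<close> serves as the reference.\<close>

lemma switches_greaterThan_eq_iff:
  assumes "k \<in> {2..n - 2}"
  shows "switches n I \<inter> {k<..} = switches n J \<inter> {k<..} \<longleftrightarrow>
    (\<forall>j \<in> {k + 2..n - 1}. (j \<in> I \<longleftrightarrow> j \<in> J) = (k + 1 \<in> I \<longleftrightarrow> k + 1 \<in> J))"
proof -
  have "i \<in> {k + 1..<n - 1} \<longleftrightarrow> i \<in> {2..n - 2} \<and> i \<in> {k<..}" for i using assms by auto
  then have "switches n I \<inter> {k<..} = switches n J \<inter> {k<..} \<longleftrightarrow>
      (\<forall>i \<in> {k + 1..<n - 1}. ((i \<in> I) \<noteq> (i + 1 \<in> I)) = ((i \<in> J) \<noteq> (i + 1 \<in> J)))"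
    unfolding switches_def by blast
  also have "\<dots> \<longleftrightarrow> (\<forall>j \<in> {k + 1..n - 1}. (j \<in> I \<longleftrightarrow> j \<in> J) = (k + 1 \<in> I \<longleftrightarrow> k + 1 \<in> J))"
    using assms by (intro switches_agree_iff) auto
  also have "{k + 1..n - 1} = insert (k + 1) {k + 2..n - 1}" using assms by auto
  finally show ?thesis by simp
qed

lemma common_switch_iff:
  assumes n: "n \<ge> 4" and two: "2 \<in> I" "2 \<in> J"
  shows "(\<exists>k \<in> switches n I \<inter> switches n J. switches n I \<inter> {..<k} \<noteq> switches n J \<inter> {..<k} \<and>
      switches n I \<inter> {k<..} \<noteq> switches n J \<inter> {k<..}) \<longleftrightarrow>
    ((\<exists>k. 3 < k \<and> k < n - 2 \<and> (k \<in> I) = (k \<in> J) \<and> (k + 1 \<in> I) = (k + 1 \<in> J) \<and>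
          (k \<in> I) \<noteq> (k + 1 \<in> I) \<and>
          (\<exists>i. 3 \<le> i \<and> i < k \<and> (i \<in> I) \<noteq> (i \<in> J)) \<and>
          (\<exists>j. k + 1 < j \<and> j \<le> n - 1 \<and> (j \<in> I) \<noteq> (j \<in> J)))
     \<or>
     (\<exists>k. 3 \<le> k \<and> k < n - 2 \<and> (k \<in> I) = (k + 1 \<in> J) \<and> (k + 1 \<in> I) = (k \<in> J) \<and>
          (k \<in> I) \<noteq> (k + 1 \<in> I) \<and>
          (\<exists>j. k + 1 < j \<and> j \<le> n - 1 \<and> (j \<in> I) = (j \<in> J))))"
    (is "?L \<longleftrightarrow> ?R1 \<or> ?R2")
proof -
  have L: "?L \<longleftrightarrow> (\<exists>k \<in> {2..n - 2}. (k \<in> I) \<noteq> (k + 1 \<in> I) \<and> (k \<in> J) \<noteq> (k + 1 \<in> J) \<and>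
     (\<exists>i \<in> {3..k}. (i \<in> I) \<noteq> (i \<in> J)) \<and>
     (\<exists>j \<in> {k + 2..n - 1}. (j \<in> I \<longleftrightarrow> j \<in> J) \<noteq> (k + 1 \<in> I \<longleftrightarrow> k + 1 \<in> J)))"
    (is "_ \<longleftrightarrow> (\<exists>k \<in> _. ?C k)")
  proof -
    have "k \<in> switches n I \<inter> switches n J \<and> switches n I \<inter> {..<k} \<noteq> switches n J \<inter> {..<k} \<and>
      switches n I \<inter> {k<..} \<noteq> switches n J \<inter> {k<..} \<longleftrightarrow> k \<in> {2..n - 2} \<and> ?C k" for k
    proof (cases "k \<in> {2..n - 2}")
      case True
      then show ?thesis
        unfolding switches_lessThan_eq_iff[OF True two] switches_greaterThan_eq_iff[OF True]
        using True by (simp add: switches_def)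
    next
      case False
      then show ?thesis unfolding switches_def by blast
    qed
    then show ?thesis by (simp only: Bex_def)
  qed
  show ?thesis
  proof
    assume ?L
    then obtain k i j where k: "k \<in> {2..n - 2}" "(k \<in> I) \<noteq> (k + 1 \<in> I)" "(k \<in> J) \<noteq> (k + 1 \<in> J)"
      and i: "i \<in> {3..k}" "(i \<in> I) \<noteq> (i \<in> J)"
      and j: "j \<in> {k + 2..n - 1}" "(j \<in> I \<longleftrightarrow> j \<in> J) \<noteq> (k + 1 \<in> I \<longleftrightarrow> k + 1 \<in> J)"
      unfolding L by blast
    \<comment> \<open>The bounds on \<open>k\<close> come from the witnesses: \<open>{3..k}\<close>
      excludes \<open>k = 2\<close>, and \<open>{k + 2..n - 1}\<close> excludes
      \<open>k = n - 2\<close>.\<close>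
    have kn: "k < n - 2" "k + 1 < j" "j \<le> n - 1" "3 \<le> k" using i j by auto
    show "?R1 \<or> ?R2"
    \<comment> \<open>As \<open>k\<close> is a common switch, the codes agree at
      \<open>k + 1\<close> iff they agree at \<open>k\<close>. If they agree, \<open>i\<close> must
      lie strictly below \<open>k\<close> and \<open>j\<close> is a disagreement; if they differ,
      \<open>j\<close> is an agreement.\<close>
    proof (cases "k \<in> I \<longleftrightarrow> k \<in> J")
      case True
      then have "i \<noteq> k" using i by blast
      then have "i < k" "3 \<le> i" "3 < k" using i by auto
      then have ?R1 using True k i(2) j(2) kn by blast
      then show ?thesis ..
    next
      case False
      then have ?R2 using k j(2) kn by blast
      then show ?thesis ..
    qed
  next
    assume "?R1 \<or> ?R2"
    then show ?L
    proof
      assume ?R1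
      then obtain k i j where k: "3 < k" "k < n - 2" "(k \<in> I) = (k \<in> J)" "(k + 1 \<in> I) = (k + 1 \<in> J)"
        "(k \<in> I) \<noteq> (k + 1 \<in> I)" and i: "3 \<le> i" "i < k" "(i \<in> I) \<noteq> (i \<in> J)"
        and j: "k + 1 < j" "j \<le> n - 1" "(j \<in> I) \<noteq> (j \<in> J)" by blast
      have "k \<in> {2..n - 2}" "i \<in> {3..k}" "j \<in> {k + 2..n - 1}" using k i j by auto
      then show ?L unfolding L using k(3-5) i(3) j(3) by blast
    next
      assume ?R2
      then obtain k j where k: "3 \<le> k" "k < n - 2" "(k \<in> I) = (k + 1 \<in> J)" "(k + 1 \<in> I) = (k \<in> J)"
        "(k \<in> I) \<noteq> (k + 1 \<in> I)" and j: "k + 1 < j" "j \<le> n - 1" "(j \<in> I) = (j \<in> J)" by blast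
      \<comment> \<open>The codes differ at \<open>k\<close> itself, which thus serves as the lower
        witness.\<close>
      have "k \<in> {2..n - 2}" "k \<in> {3..k}" "j \<in> {k + 2..n - 1}" using k j by auto
      then show ?L unfolding L using k(3-5) j(3) by blast
    qed
  qed
qed

theorem theorem3:
  fixes n :: nat and xs ys :: "nat list"
  assumes "n \<ge> 4"
    and "pyr_list n xs" and "pyr_list n ys"
    and "cycle_edges xs \<noteq> cycle_edges ys"
  shows "\<not> adjacent_vertices (PYR n) (charvec (cycle_edges xs)) (charvec (cycle_edges ys))
    \<longleftrightarrow>
    ((\<exists>k. 3 < k \<and> k < n - 2 \<and>
          code n xs k = code n ys k \<and> code n xs (k + 1) = code n ys (k + 1) \<and>
          code n xs k \<noteq> code n xs (k + 1) \<and>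
          (\<exists>i. 3 \<le> i \<and> i < k \<and> code n xs i \<noteq> code n ys i) \<and>
          (\<exists>j. k + 1 < j \<and> j \<le> n - 1 \<and> code n xs j \<noteq> code n ys j))
     \<or>
     (\<exists>k. 3 \<le> k \<and> k < n - 2 \<and>
          code n xs k = code n ys (k + 1) \<and> code n xs (k + 1) = code n ys k \<and>
          code n xs k \<noteq> code n xs (k + 1) \<and>
          (\<exists>j. k + 1 < j \<and> j \<le> n - 1 \<and> code n xs j = code n ys j)))"
proof -
  let ?I = "incr_part n xs" and ?J = "incr_part n ys"
  have sub: "switches n ?I \<subseteq> {2..n - 2}" "switches n ?J \<subseteq> {2..n - 2}"
    by (auto simp: switches_def)
  note xs = pyr_list_code[OF assms(1,2)] and ys = pyr_list_code[OF assms(1,3)]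
  show ?thesis
    unfolding PYR_def PT_eq[OF assms(1)] xs(3) ys(3) code_def
      not_adjacent_tour_edges_iff[OF assms(1) sub]
    by (rule common_switch_iff[OF assms(1) xs(2) ys(2)])
qed

end
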